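(* Let $\mathbb{D}^n$ be the open unit polydisc in $\mathbb{C}^n$, and let $m_1,\dots,m_{2n}\in\mathbb{N}$ be such that $\gcd(m_i,m_j)=1$ for all $i\neq j$. Then $$[z_1^{m_1},\dots,z_n^{m_n},\ \bar{z}_1^{\,m_{n+1}},\dots,\bar{z}_n^{\,m_{2n}};\ \overline{\mathbb{D}}^n]=\mathcal{C}(\overline{\mathbb{D}}^n).$$
   Context: $\mathbb{N}$ denotes the positive integers. $\mathcal{C}(\overline{\mathbb{D}}^n)$ is the set of all continuous complex-valued functions on the closed unit polydisc $\overline{\mathbb{D}}^n$. For continuous functions $f_1,\dots,f_N$ on $\overline{\mathbb{D}}^n$, $[f_1,\dots,f_N;\overline{\mathbb{D}}^n]$ denotes the uniform algebra generated by them, i.e. the uniform closure in $\mathcal{C}(\overline{\mathbb{D}}^n)$ of the set of complex polynomials in $f_1,\dots,f_N$. *)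

theory Defs
  imports "HOL-Analysis.Analysis"
begin

definition closed_polydisc :: "(complex ^ 'n) set" where
  "closed_polydisc = {z. \<forall>i. z $ i \<in> cball 0 1}"

text \<open>Functions on \<open>K\<close> are represented by extensional functions (\<open>undefined\<close> off \<open>K\<close>),
  so that equality of functions means equality on \<open>K\<close>.\<close>

definition continuous_functions :: "'a::topological_space set \<Rightarrow> ('a \<Rightarrow> complex) set" where
  "continuous_functions K = {g \<in> extensional K. continuous_on K g}"

text \<open>A polynomial in the family \<open>f\<close> is given by a finite set \<open>A\<close> of multi-indices
  and a coefficient function \<open>c\<close>; constants are included.\<close>

definition polynomials_in :: "'a set \<Rightarrow> ('k::finite \<Rightarrow> 'a \<Rightarrow> complex) \<Rightarrow> ('a \<Rightarrow> complex) set" where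
  "polynomials_in K f =
     {restrict (\<lambda>x. \<Sum>\<alpha>\<in>A. c \<alpha> * (\<Prod>k\<in>UNIV. f k x ^ \<alpha> k)) K
       | (A :: ('k \<Rightarrow> nat) set) (c :: ('k \<Rightarrow> nat) \<Rightarrow> complex). finite A}"

definition uniform_algebra ::
    "('k::finite \<Rightarrow> 'a::topological_space \<Rightarrow> complex) \<Rightarrow> 'a set \<Rightarrow> ('a \<Rightarrow> complex) set" where
  "uniform_algebra f K =
     {g \<in> continuous_functions K.
        \<forall>e>0. \<exists>p\<in>polynomials_in K f. \<forall>x\<in>K. dist (p x) (g x) < e}"

text \<open>The exponents are indexed by \<open>'n + 'n\<close>: \<open>Inl i\<close> stands for the index \<open>i\<close> and
  \<open>Inr i\<close> for the index \<open>n + i\<close>.\<close>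

definition power_generators :: "('n + 'n \<Rightarrow> nat) \<Rightarrow> 'n + 'n \<Rightarrow> complex ^ 'n \<Rightarrow> complex" where
  "power_generators m k z =
     (case k of Inl i \<Rightarrow> (z $ i) ^ m (Inl i) | Inr i \<Rightarrow> cnj (z $ i) ^ m (Inr i))"

end

theory Submission
  imports Defs
begin

text \<open>
  The generators separate points, but the algebra they generate is not visibly closed under
  complex conjugation, so the Stone-Weierstrass theorem does not apply to it directly. The proof
  produces enough real-valued members by hand.

  Fix a coordinate \<open>z\<close> and write \<open>a\<close>, \<open>b\<close> for the exponents of \<open>z\<close> and of \<open>cnj z\<close>. The product
  \<open>(z ^ a) ^ b * (cnj z ^ b) ^ a = \<bar>z\<bar> ^ (2 * a * b)\<close> is real-valued and lies in the algebra. By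
  Weierstrass approximation on its range, so does every continuous function of it
  (\<open>in_algebra_real_comp\<close>), in particular every continuous function of \<open>\<bar>z\<bar>\<close>. As \<open>a\<close> and \<open>b\<close> are
  coprime, there are \<open>k\<close> and \<open>l\<close> with \<open>a * k = b * l + 1\<close>, and then
  \<open>(z ^ a) ^ k * (cnj z ^ b) ^ l = z * \<bar>z\<bar> ^ (2 * b * l)\<close>. The factor \<open>\<bar>z\<bar> ^ N\<close> can be removed up to
  a uniformly small error by multiplying with \<open>1 / max \<bar>z\<bar> d ^ N\<close> for small \<open>d > 0\<close>, since the
  function \<open>z\<close> is itself small where \<open>\<bar>z\<bar> < d\<close> (\<open>in_algebra_cancel_norm_power\<close>). So \<open>z\<close> lies in the
  algebra, and by symmetry \<open>cnj z\<close> does. Hence the algebra contains the real and imaginary parts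
  of all coordinates, and the real Stone-Weierstrass theorem finishes the proof.
\<close>

section \<open>Uniform algebras are closed algebras\<close>

text \<open>Membership in a uniform algebra for functions that need not be extensional; it lets the
  closure properties be stated with plain function terms.\<close>

definition in_algebra ::
    "('k::finite \<Rightarrow> 'a::topological_space \<Rightarrow> complex) \<Rightarrow> 'a set \<Rightarrow> ('a \<Rightarrow> complex) \<Rightarrow> bool" where
  "in_algebra F K f \<longleftrightarrow> restrict f K \<in> uniform_algebra F K"

lemma in_algebra_iff:
  "in_algebra F K f \<longleftrightarrow> continuous_on K f \<and>
     (\<forall>e>0. \<exists>p\<in>polynomials_in K F. \<forall>x\<in>K. dist (p x) (f x) < e)"
proof -
  have "continuous_on K (restrict f K) \<longleftrightarrow> continuous_on K f"
    by (rule continuous_on_cong) auto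
  then show ?thesis
    by (simp add: in_algebra_def uniform_algebra_def continuous_functions_def)
qed

lemma in_algebra_cong:
  assumes "in_algebra F K f" "\<And>x. x \<in> K \<Longrightarrow> f x = g x"
  shows "in_algebra F K g"
proof -
  have "restrict g K = restrict f K"
    using assms(2) by (auto simp: restrict_def)
  then show ?thesis using assms(1) by (simp add: in_algebra_def)
qed

text \<open>A sum of monomials over an arbitrary finite index set may repeat multi-indices; collecting
  equal ones brings it into the normal form required by the definition. Sums and products of
  polynomials are then handled by choosing the index set to be a disjoint sum or a product.\<close>

lemma polynomials_inI:
  assumes "finite I"
    and f: "\<And>x. x \<in> K \<Longrightarrow> f x = (\<Sum>i\<in>I. c i * (\<Prod>k\<in>UNIV. F k x ^ e i k))"
  shows "restrict f K \<in> polynomials_in K F"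
proof -
  define c' where "c' \<alpha> = (\<Sum>i\<in>{i. i \<in> I \<and> e i = \<alpha>}. c i)" for \<alpha>
  have "f x = (\<Sum>\<alpha>\<in>e ` I. c' \<alpha> * (\<Prod>k\<in>UNIV. F k x ^ \<alpha> k))" if "x \<in> K" for x
  proof -
    have "f x = (\<Sum>\<alpha>\<in>e ` I. \<Sum>i\<in>{i. i \<in> I \<and> e i = \<alpha>}. c i * (\<Prod>k\<in>UNIV. F k x ^ e i k))"
      unfolding f[OF that] by (rule sum.image_gen[OF assms(1)])
    also have "\<dots> = (\<Sum>\<alpha>\<in>e ` I. c' \<alpha> * (\<Prod>k\<in>UNIV. F k x ^ \<alpha> k))"
      by (rule sum.cong) (auto simp: c'_def sum_distrib_right intro!: sum.cong)
    finally show ?thesis .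
  qed
  then have "restrict f K = restrict (\<lambda>x. \<Sum>\<alpha>\<in>e ` I. c' \<alpha> * (\<Prod>k\<in>UNIV. F k x ^ \<alpha> k)) K"
    by (auto simp: restrict_def)
  then show ?thesis
    unfolding polynomials_in_def using assms(1) by blast
qed

lemma polynomials_inE:
  assumes "p \<in> polynomials_in K F"
  obtains A c where "finite A"
    "\<And>x. x \<in> K \<Longrightarrow> p x = (\<Sum>\<alpha>\<in>A. c \<alpha> * (\<Prod>k\<in>UNIV. F k x ^ \<alpha> k))"
  using assms that unfolding polynomials_in_def by fastforce

lemma polynomials_in_add:
  assumes "p \<in> polynomials_in K F" "q \<in> polynomials_in K F"
  shows "restrict (\<lambda>x. p x + q x) K \<in> polynomials_in K F"
proof -
  obtain A c where A: "finite A" and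
    p: "\<And>x. x \<in> K \<Longrightarrow> p x = (\<Sum>\<alpha>\<in>A. c \<alpha> * (\<Prod>k\<in>UNIV. F k x ^ \<alpha> k))"
    using polynomials_inE[OF assms(1)] by metis
  obtain B d where B: "finite B" and
    q: "\<And>x. x \<in> K \<Longrightarrow> q x = (\<Sum>\<alpha>\<in>B. d \<alpha> * (\<Prod>k\<in>UNIV. F k x ^ \<alpha> k))"
    using polynomials_inE[OF assms(2)] by metis
  show ?thesis
    by (rule polynomials_inI[where I = "A <+> B" and c = "case_sum c d"
          and e = "case_sum (\<lambda>\<alpha>. \<alpha>) (\<lambda>\<alpha>. \<alpha>)"])
       (use A B in \<open>simp_all add: p q sum.Plus\<close>)
qed

lemma polynomials_in_mult:
  assumes "p \<in> polynomials_in K F" "q \<in> polynomials_in K F"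
  shows "restrict (\<lambda>x. p x * q x) K \<in> polynomials_in K F"
proof -
  obtain A c where A: "finite A" and
    p: "\<And>x. x \<in> K \<Longrightarrow> p x = (\<Sum>\<alpha>\<in>A. c \<alpha> * (\<Prod>k\<in>UNIV. F k x ^ \<alpha> k))"
    using polynomials_inE[OF assms(1)] by metis
  obtain B d where B: "finite B" and
    q: "\<And>x. x \<in> K \<Longrightarrow> q x = (\<Sum>\<alpha>\<in>B. d \<alpha> * (\<Prod>k\<in>UNIV. F k x ^ \<alpha> k))"
    using polynomials_inE[OF assms(2)] by metis
  show ?thesis
  proof (rule polynomials_inI[where I = "A \<times> B" and c = "\<lambda>(\<alpha>, \<beta>). c \<alpha> * d \<beta>"
        and e = "\<lambda>(\<alpha>, \<beta>) k. \<alpha> k + \<beta> k"])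
    show "finite (A \<times> B)" using A B by simp
    show "p x * q x = (\<Sum>i\<in>A \<times> B. (case i of (\<alpha>, \<beta>) \<Rightarrow> c \<alpha> * d \<beta>) *
            (\<Prod>k\<in>UNIV. F k x ^ (case i of (\<alpha>, \<beta>) \<Rightarrow> \<lambda>k. \<alpha> k + \<beta> k) k))" if "x \<in> K" for x
      by (simp add: p[OF that] q[OF that] sum_product sum.cartesian_product power_add
          prod.distrib case_prod_unfold mult_ac)
  qed
qed

lemma in_algebra_const: "in_algebra F K (\<lambda>_. c)"
proof -
  have "restrict (\<lambda>_. c) K \<in> polynomials_in K F"
    by (rule polynomials_inI[where I = "{()}" and c = "\<lambda>_. c" and e = "\<lambda>_ _. 0"]) auto
  then show ?thesis
    unfolding in_algebra_iff by (force intro: bexI[of _ "restrict (\<lambda>_. c) K"])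
qed

lemma in_algebra_generator:
  assumes "continuous_on K (F k)"
  shows "in_algebra F K (F k)"
proof -
  have "F k x = (\<Prod>j\<in>UNIV. F j x ^ (if j = k then 1 else 0))" for x
    by (simp add: if_distrib[of "\<lambda>n. _ ^ n"] prod.delta cong: if_cong)
  then have "restrict (F k) K \<in> polynomials_in K F"
    by (intro polynomials_inI[where I = "{()}" and c = "\<lambda>_. 1"
          and e = "\<lambda>_ j. if j = k then 1 else 0"]) auto
  then show ?thesis
    using assms unfolding in_algebra_iff by (force intro: bexI[of _ "restrict (F k) K"])
qed

lemma in_algebra_add:
  assumes f: "in_algebra F K f" and g: "in_algebra F K g"
  shows "in_algebra F K (\<lambda>x. f x + g x)"
  unfolding in_algebra_iff
proof (intro conjI allI impI)
  show "continuous_on K (\<lambda>x. f x + g x)"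
    using f g unfolding in_algebra_iff by (intro continuous_intros) auto
  fix e :: real assume "e > 0"
  then have "e / 2 > 0" by simp
  then obtain p q where pq: "p \<in> polynomials_in K F" "\<And>x. x \<in> K \<Longrightarrow> dist (p x) (f x) < e / 2"
    "q \<in> polynomials_in K F" "\<And>x. x \<in> K \<Longrightarrow> dist (q x) (g x) < e / 2"
    using f g unfolding in_algebra_iff by metis
  have "dist (p x + q x) (f x + g x) < e" if "x \<in> K" for x
    using dist_triangle_add[of "p x" "q x" "f x" "g x"] pq(2,4)[OF that] by linarith
  then show "\<exists>p\<in>polynomials_in K F. \<forall>x\<in>K. dist (p x) (f x + g x) < e"
    using polynomials_in_add[OF pq(1,3)] by (intro bexI) auto
qed

lemma in_algebra_mult:
  assumes K: "compact K" and f: "in_algebra F K f" and g: "in_algebra F K g"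
  shows "in_algebra F K (\<lambda>x. f x * g x)"
  unfolding in_algebra_iff
proof (intro conjI allI impI)
  have cont: "continuous_on K f" "continuous_on K g"
    using f g unfolding in_algebra_iff by auto
  then show "continuous_on K (\<lambda>x. f x * g x)" by (intro continuous_intros)
  have "bounded (f ` K)" "bounded (g ` K)"
    using cont K by (auto intro!: compact_imp_bounded compact_continuous_image)
  then obtain M N where MN: "M > 0" "\<And>x. x \<in> K \<Longrightarrow> norm (f x) \<le> M"
    "N > 0" "\<And>x. x \<in> K \<Longrightarrow> norm (g x) \<le> N"
    unfolding bounded_pos by auto
  fix e :: real assume "e > 0"
  (* p q - f g = (p - f) q + f (q - g), where norm q is at most N + 1 *)
  define d where "d = min 1 (e / (M + N + 1))"
  have d: "d > 0" "d \<le> 1"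
    using \<open>e > 0\<close> MN(1,3) by (auto simp: d_def)
  have "d \<le> e / (M + N + 1)" by (simp add: d_def)
  then have de: "d * (M + N + 1) \<le> e"
    using MN(1,3) by (subst (asm) pos_le_divide_eq) auto
  obtain p q where pq: "p \<in> polynomials_in K F" "\<And>x. x \<in> K \<Longrightarrow> dist (p x) (f x) < d"
    "q \<in> polynomials_in K F" "\<And>x. x \<in> K \<Longrightarrow> dist (q x) (g x) < d"
    using f g d(1) unfolding in_algebra_iff by metis
  have "dist (p x * q x) (f x * g x) < e" if "x \<in> K" for x
  proof -
    have p: "norm (p x - f x) < d" and q: "norm (q x - g x) < d"
      using pq(2,4)[OF that] by (auto simp: dist_norm)
    have "norm (q x) \<le> N + 1"
      using norm_triangle_ineq[of "q x - g x" "g x"] q d(2) MN(4)[OF that] by simp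
    then have "norm (p x - f x) * norm (q x) \<le> d * (N + 1)"
      using p d(1) by (intro mult_mono) auto
    moreover have "norm (f x) * norm (q x - g x) < M * d"
      using mult_right_mono[OF MN(2)[OF that] norm_ge_zero] mult_strict_left_mono[OF q MN(1)]
      by (rule order.strict_trans1)
    moreover have "p x * q x - f x * g x = (p x - f x) * q x + f x * (q x - g x)"
      by (simp add: algebra_simps)
    then have "norm (p x * q x - f x * g x)
        \<le> norm (p x - f x) * norm (q x) + norm (f x) * norm (q x - g x)"
      using norm_triangle_ineq[of "(p x - f x) * q x" "f x * (q x - g x)"]
      by (simp add: norm_mult)
    ultimately show ?thesis
      using de by (simp add: dist_norm algebra_simps)
  qed
  then show "\<exists>p\<in>polynomials_in K F. \<forall>x\<in>K. dist (p x) (f x * g x) < e"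
    using polynomials_in_mult[OF pq(1,3)] by (intro bexI) auto
qed

lemma in_algebra_power:
  assumes "compact K" "in_algebra F K f"
  shows "in_algebra F K (\<lambda>x. f x ^ n)"
  by (induction n) (simp_all add: in_algebra_const in_algebra_mult assms)

lemma in_algebra_uniform_limit:
  assumes cont: "continuous_on K f"
    and approx: "\<And>e. e > 0 \<Longrightarrow> \<exists>g. in_algebra F K g \<and> (\<forall>x\<in>K. dist (g x) (f x) < e)"
  shows "in_algebra F K f"
  unfolding in_algebra_iff
proof (intro conjI allI impI cont)
  fix e :: real assume "e > 0"
  then have "e / 2 > 0" by simp
  then obtain g p where "p \<in> polynomials_in K F" "\<And>x. x \<in> K \<Longrightarrow> dist (p x) (g x) < e / 2"
    "\<And>x. x \<in> K \<Longrightarrow> dist (g x) (f x) < e / 2"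
    using approx unfolding in_algebra_iff by metis
  then show "\<exists>p\<in>polynomials_in K F. \<forall>x\<in>K. dist (p x) (f x) < e"
    by (metis dist_triangle_half_r dist_commute)
qed

section \<open>Real-valued members\<close>

text \<open>The real Stone-Weierstrass theorem pulled back along a map \<open>h\<close>: the real functions on \<open>h ` K\<close>
  whose composition with \<open>h\<close> lies in the algebra form a closed real algebra. Taking \<open>h\<close> to be the
  identity or a real-valued member of the algebra gives the two uses below.\<close>

lemma in_algebra_Stone_Weierstrass:
  fixes h :: "'a::topological_space \<Rightarrow> 'b::t2_space" and \<phi> :: "'b \<Rightarrow> real"
  assumes K: "compact K" and h: "continuous_on K h"
    and sep: "\<And>s t. s \<in> h ` K \<Longrightarrow> t \<in> h ` K \<Longrightarrow> s \<noteq> t \<Longrightarrow>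
      \<exists>\<psi>::'b \<Rightarrow> real. continuous_on (h ` K) \<psi> \<and> in_algebra F K (\<lambda>x. of_real (\<psi> (h x))) \<and> \<psi> s \<noteq> \<psi> t"
    and \<phi>: "continuous_on (h ` K) \<phi>"
  shows "in_algebra F K (\<lambda>x. of_real (\<phi> (h x)))"
proof (rule in_algebra_uniform_limit)
  show "continuous_on K (\<lambda>x. complex_of_real (\<phi> (h x)))"
    using continuous_on_compose2[OF \<phi> h] by (intro continuous_intros) auto
  fix e :: real assume "e > 0"
  define P where "P \<psi> \<longleftrightarrow> continuous_on (h ` K) \<psi> \<and> in_algebra F K (\<lambda>x. of_real (\<psi> (h x)))"
    for \<psi> :: "'b \<Rightarrow> real"
  have "\<exists>\<psi>. P \<psi> \<and> (\<forall>t\<in>h ` K. \<bar>\<phi> t - \<psi> t\<bar> < e)"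
  proof (rule Stone_Weierstrass_HOL)
    show "compact (h ` K)" using compact_continuous_image[OF h K] .
    show "P (\<lambda>_. c)" for c by (simp add: P_def in_algebra_const)
    show "P (\<lambda>t. \<psi> t + \<eta> t)" if "P \<psi> \<and> P \<eta>" for \<psi> \<eta>
      using that in_algebra_add[where f = "\<lambda>x. of_real (\<psi> (h x))" and g = "\<lambda>x. of_real (\<eta> (h x))"]
      by (auto simp: P_def intro: continuous_intros)
    show "P (\<lambda>t. \<psi> t * \<eta> t)" if "P \<psi> \<and> P \<eta>" for \<psi> \<eta>
      using that in_algebra_mult[OF K, where f = "\<lambda>x. of_real (\<psi> (h x))" and g = "\<lambda>x. of_real (\<eta> (h x))"]
      by (auto simp: P_def intro: continuous_intros)
    show "\<exists>\<psi>. P \<psi> \<and> \<psi> s \<noteq> \<psi> t" if "s \<in> h ` K \<and> t \<in> h ` K \<and> s \<noteq> t" for s t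
      using sep that unfolding P_def by blast
  qed (use \<phi> \<open>e > 0\<close> in \<open>auto simp: P_def\<close>)
  then obtain \<psi> where "in_algebra F K (\<lambda>x. of_real (\<psi> (h x)))" "\<And>x. x \<in> K \<Longrightarrow> \<bar>\<phi> (h x) - \<psi> (h x)\<bar> < e"
    by (auto simp: P_def)
  then show "\<exists>g. in_algebra F K g \<and> (\<forall>x\<in>K. dist (g x) (complex_of_real (\<phi> (h x))) < e)"
    by (intro exI[of _ "\<lambda>x. of_real (\<psi> (h x))"])
       (auto simp: dist_norm abs_minus_commute simp flip: of_real_diff)
qed

lemma in_algebra_real_comp:
  fixes h :: "'a::topological_space \<Rightarrow> real"
  assumes K: "compact K" and h: "in_algebra F K (\<lambda>x. of_real (h x))"
    and \<phi>: "continuous_on UNIV \<phi>"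
  shows "in_algebra F K (\<lambda>x. of_real (\<phi> (h x)))"
proof (rule in_algebra_Stone_Weierstrass[OF K, where h = h and \<phi> = \<phi>])
  have "continuous_on K (\<lambda>x. complex_of_real (h x))"
    using h unfolding in_algebra_iff by blast
  from continuous_on_Re[OF this] show "continuous_on K h" by simp
  show "continuous_on (h ` K) \<phi>" using \<phi> continuous_on_subset by blast
  show "\<exists>\<psi>::real \<Rightarrow> real. continuous_on (h ` K) \<psi> \<and> in_algebra F K (\<lambda>x. of_real (\<psi> (h x))) \<and> \<psi> s \<noteq> \<psi> t"
    if "s \<noteq> t" for s t
    using h that by (intro exI[of _ "\<lambda>t. t"]) auto
qed

text \<open>Multiplying \<open>u * \<bar>u\<bar> ^ N\<close> by \<open>1 / max \<bar>u\<bar> d ^ N\<close> gives \<open>u\<close> where \<open>\<bar>u\<bar> \<ge> d\<close>, and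
  elsewhere something between \<open>0\<close> and \<open>u\<close>, so that the error there is at most \<open>\<bar>u\<bar> < d\<close>.\<close>

lemma in_algebra_cancel_norm_power:
  assumes K: "compact K" and cont: "continuous_on K u"
    and norm: "in_algebra F K (\<lambda>x. of_real (norm (u x)))"
    and u: "in_algebra F K (\<lambda>x. u x * of_real (norm (u x)) ^ N)"
  shows "in_algebra F K u"
proof (rule in_algebra_uniform_limit[OF cont])
  fix d :: real assume d: "d > 0"
  define g where "g = (\<lambda>x. u x * of_real (norm (u x)) ^ N * of_real (1 / max (norm (u x)) d ^ N))"
  have "continuous_on UNIV (\<lambda>t::real. 1 / max t d ^ N)"
    using d by (intro continuous_intros) (auto simp: max_def)
  from in_algebra_mult[OF K u in_algebra_real_comp[OF K norm this]]
  have "in_algebra F K g" unfolding g_def .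
  moreover have "dist (g x) (u x) < d" for x
  proof (cases "norm (u x) < d")
    case False
    then have "max (norm (u x)) d = norm (u x)" "norm (u x) \<noteq> 0" using d by auto
    then have "g x = u x" by (simp add: g_def)
    then show ?thesis using d by simp
  next
    case True
    define r where "r = (norm (u x) / d) ^ N"
    have r: "0 \<le> r" "r \<le> 1"
      using True d by (auto simp: r_def intro!: power_le_one)
    have "g x - u x = u x * of_real (r - 1)"
      using True by (simp add: g_def r_def max_def power_divide algebra_simps)
    then have "norm (g x - u x) = norm (u x) * (1 - r)"
      using r by (simp only: norm_mult norm_of_real) simp
    also have "\<dots> \<le> norm (u x)"
      using r by (simp add: mult_left_le)
    finally show ?thesis using True by (simp add: dist_norm)
  qed
  ultimately show "\<exists>g. in_algebra F K g \<and> (\<forall>x\<in>K. dist (g x) (u x) < d)"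
    by blast
qed

section \<open>Recovering a function from coprime powers of it and its conjugate\<close>

text \<open>The argument for one coordinate, with \<open>u\<close> in place of \<open>z\<close>. The hypotheses are symmetric
  under exchanging \<open>(u, a)\<close> with \<open>(cnj u, b)\<close>, so the lemma also yields \<open>cnj u\<close>.\<close>

lemma in_algebra_of_coprime_powers:
  assumes K: "compact K" and cont: "continuous_on K u"
    and a: "a > 0" and b: "b > 0" and "coprime a b"
    and ua: "in_algebra F K (\<lambda>x. u x ^ a)" and ub: "in_algebra F K (\<lambda>x. cnj (u x) ^ b)"
  shows "in_algebra F K u"
proof -
  have norm_power: "w ^ n * cnj w ^ n = of_real (norm w) ^ (2 * n)" for w and n :: nat
    by (simp add: power_mult_distrib[symmetric] complex_norm_square[symmetric] power_mult)
  define N where "N = 2 * (a * b)"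
  have "N > 0" using a b by (simp add: N_def)
  have "in_algebra F K (\<lambda>x. (u x ^ a) ^ b * (cnj (u x) ^ b) ^ a)"
    by (intro in_algebra_mult in_algebra_power K ua ub)
  then have "in_algebra F K (\<lambda>x. of_real (norm (u x) ^ N))"
    by (rule in_algebra_cong)
       (simp add: N_def norm_power flip: power_mult, simp add: norm_power mult.commute[of b a])
  (* the N-th root is continuous on all of the reals, so it may be composed with norm u ^ N *)
  then have "in_algebra F K (\<lambda>x. of_real (root N (norm (u x) ^ N)))"
    by (rule in_algebra_real_comp[OF K]) (intro continuous_intros)
  then have norm: "in_algebra F K (\<lambda>x. of_real (norm (u x)))"
    using \<open>N > 0\<close> by (simp add: real_root_power_cancel)
  obtain k l where kl: "a * k = b * l + 1"
    using bezout_nat[of a b] a \<open>coprime a b\<close> by auto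
  have "in_algebra F K (\<lambda>x. (u x ^ a) ^ k * (cnj (u x) ^ b) ^ l)"
    by (intro in_algebra_mult in_algebra_power K ua ub)
  then have "in_algebra F K (\<lambda>x. u x * of_real (norm (u x)) ^ (2 * (b * l)))"
    by (rule in_algebra_cong) (simp add: kl mult.assoc norm_power flip: power_mult)
  then show ?thesis
    by (rule in_algebra_cancel_norm_power[OF K cont norm])
qed

section \<open>The polydisc\<close>

lemma compact_closed_polydisc: "compact (closed_polydisc :: (complex ^ 'n::finite) set)"
proof -
  have "closed (closed_polydisc :: (complex ^ 'n) set)"
    unfolding closed_polydisc_def mem_cball
    by (intro closed_Collect_all closed_Collect_le continuous_intros)
  moreover have "norm z \<le> (\<Sum>i\<in>(UNIV::'n set). 1)" if "z \<in> closed_polydisc" for z :: "complex ^ 'n"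
  proof -
    have "norm z \<le> (\<Sum>i\<in>UNIV. norm (z $ i))"
      unfolding norm_vec_def by (rule L2_set_le_sum) simp
    also have "\<dots> \<le> (\<Sum>i\<in>(UNIV::'n set). 1)"
      using that by (intro sum_mono) (auto simp: closed_polydisc_def)
    finally show ?thesis .
  qed
  then have "bounded (closed_polydisc :: (complex ^ 'n) set)"
    unfolding bounded_iff by blast
  ultimately show ?thesis by (simp add: compact_eq_bounded_closed)
qed

text \<open>An algebra containing all coordinates and their conjugates contains the real and imaginary
  parts of the coordinates; these are real-valued and separate points.\<close>

lemma in_algebra_of_coordinates:
  fixes K :: "(complex ^ 'n::finite) set"
  assumes K: "compact K"
    and z: "\<And>i. in_algebra F K (\<lambda>z. z $ i)" and cz: "\<And>i. in_algebra F K (\<lambda>z. cnj (z $ i))"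
    and g: "continuous_on K g"
  shows "in_algebra F K g"
proof -
  have "in_algebra F K (\<lambda>z. 1 / 2 * (z $ i + cnj (z $ i)))" for i
    by (intro in_algebra_mult in_algebra_const in_algebra_add K z cz)
  then have Re: "in_algebra F K (\<lambda>z. of_real (Re (z $ i)))" for i
    by (rule in_algebra_cong) (simp add: complex_eq_iff)
  have "in_algebra F K (\<lambda>z. - \<i> / 2 * (z $ i + (- 1) * cnj (z $ i)))" for i
    by (intro in_algebra_mult in_algebra_const in_algebra_add K z cz)
  then have Im: "in_algebra F K (\<lambda>z. of_real (Im (z $ i)))" for i
    by (rule in_algebra_cong) (simp add: complex_eq_iff)
  have real: "in_algebra F K (\<lambda>z. of_real (\<phi> z))" if \<phi>: "continuous_on K \<phi>" for \<phi> :: "_ \<Rightarrow> real"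
  proof (rule in_algebra_Stone_Weierstrass[OF K, where h = "\<lambda>z. z" and \<phi> = \<phi>])
    fix s t :: "complex ^ 'n" assume "s \<noteq> t"
    then obtain i where "Re (s $ i) \<noteq> Re (t $ i) \<or> Im (s $ i) \<noteq> Im (t $ i)"
      by (auto simp: vec_eq_iff complex_eq_iff)
    moreover have "continuous_on ((\<lambda>z. z) ` K) (\<lambda>z. Re (z $ i))"
      "continuous_on ((\<lambda>z. z) ` K) (\<lambda>z. Im (z $ i))"
      by (intro continuous_intros)+
    ultimately show "\<exists>\<psi>::_ \<Rightarrow> real. continuous_on ((\<lambda>z. z) ` K) \<psi> \<and>
        in_algebra F K (\<lambda>x. of_real (\<psi> x)) \<and> \<psi> s \<noteq> \<psi> t"
      using Re[of i] Im[of i] by blast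
  qed (use \<phi> in auto)
  have "in_algebra F K (\<lambda>z. of_real (Re (g z)) + \<i> * of_real (Im (g z)))"
    by (intro in_algebra_mult in_algebra_const in_algebra_add K real continuous_intros g)
  then show ?thesis
    by (rule in_algebra_cong) (simp add: complex_eq_iff)
qed

theorem theorem1p11:
  fixes m :: "'n::finite + 'n \<Rightarrow> nat"
  assumes "\<And>k. m k > 0"
    and "\<And>i j. i \<noteq> j \<Longrightarrow> gcd (m i) (m j) = 1"
  shows "uniform_algebra (power_generators m) (closed_polydisc :: (complex ^ 'n) set)
         = continuous_functions closed_polydisc"
proof
  let ?F = "power_generators m" and ?K = "closed_polydisc :: (complex ^ 'n) set"
  show "uniform_algebra ?F ?K \<subseteq> continuous_functions ?K"
    by (auto simp: uniform_algebra_def)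
  note K = compact_closed_polydisc[where ?'n = 'n]
  have l: "?F (Inl i) = (\<lambda>z. (z $ i) ^ m (Inl i))" for i
    by (auto simp: power_generators_def)
  have r: "?F (Inr i) = (\<lambda>z. cnj (z $ i) ^ m (Inr i))" for i
    by (auto simp: power_generators_def)
  have left: "in_algebra ?F ?K (\<lambda>z. (z $ i) ^ m (Inl i))" for i
    using in_algebra_generator[of ?K ?F "Inl i"] unfolding l by (simp add: continuous_intros)
  have right: "in_algebra ?F ?K (\<lambda>z. cnj (z $ i) ^ m (Inr i))" for i
    using in_algebra_generator[of ?K ?F "Inr i"] unfolding r by (simp add: continuous_intros)
  have coprime: "coprime (m (Inl i)) (m (Inr i))" for i
    using assms(2)[of "Inl i" "Inr i"] by (simp add: coprime_iff_gcd_eq_1)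
  have z: "in_algebra ?F ?K (\<lambda>z. z $ i)" for i
    by (rule in_algebra_of_coprime_powers[OF K _ assms(1) assms(1) coprime left right])
       (intro continuous_intros)
  have cz: "in_algebra ?F ?K (\<lambda>z. cnj (z $ i))" for i
  proof (rule in_algebra_of_coprime_powers[OF K _ assms(1) assms(1) _ right])
    show "continuous_on ?K (\<lambda>z. cnj (z $ i))" by (intro continuous_intros)
    show "coprime (m (Inr i)) (m (Inl i))" using coprime[of i] by (simp add: coprime_commute)
    show "in_algebra ?F ?K (\<lambda>z. cnj (cnj (z $ i)) ^ m (Inl i))" using left[of i] by simp
  qed
  show "continuous_functions ?K \<subseteq> uniform_algebra ?F ?K"
  proof
    fix g assume "g \<in> continuous_functions ?K"
    then have "continuous_on ?K g" "restrict g ?K = g"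
      by (auto simp: continuous_functions_def extensional_restrict)
    then show "g \<in> uniform_algebra ?F ?K"
      using in_algebra_of_coordinates[OF K z cz] unfolding in_algebra_def by metis
  qed
qed

end
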